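(* Suppose that for the given $\mathbf f\in\mathbb R^n$ the set $\mathcal S_a$ is not empty. If $\overline{\varsigma}\in\mathcal S_a$ is a stationary point of $\Pi^d$, then $$\overline{x}=(G(\overline{\varsigma}))^{-1}\mathbf f$$ is a stationary point of $\Pi$ and $$\Pi(\overline{x})=\Pi^d(\overline{\varsigma}).$$
   Context: Let $n,m,p$ be fixed positive integers, $I_m=\{1,\dots,m\}$, $I_p=\{1,\dots,p\}$. Let $\mathbf f\in\mathbb R^n$, let $A\in\mathbb R^{n\times n}$ be symmetric, let $b_j>0$ for $j\in I_p$, let $\alpha_i,\theta_j\in\mathbb R$ for $i\in I_m$, $j\in I_p$, and put $\alpha=(\alpha_1,\dots,\alpha_m)^t$, $\theta=(\theta_1,\dots,\theta_p)^t$. Let $\{B_i\}_{i\in I_m}$ and $\{C_j\}_{j\in I_p}$ be symmetric positive semidefinite $n\times n$ real matrices such that the cone generated by all of them contains a positive definite matrix. Primal function $\Pi:\mathbb R^n\to\mathbb R$: $$\Pi(x)=\sum_{i\in I_m}\exp\left(\tfrac12x^tB_ix-\alpha_i\right)+\sum_{j\in I_p}\tfrac{b_j}{2}\left(\tfrac12x^tC_jx-\theta_j\right)^2+\tfrac12x^tAx-\mathbf f^tx.$$ For $\varsigma=(\tau,\sigma)\in\mathbb R^{m}\times\mathbb R^p$ put $G(\varsigma)=A+\sum_{i\in I_m}\tau_iB_i+\sum_{j\in I_p}\sigma_jC_j$. Let $$\mathcal V_a^*=\{(\tau,\sigma)\in\mathbb R^{m+p}:\tau_i\in[\exp(-\alpha_i),\infty),\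 \sigma_j\in[-b_j\theta_j,\infty)\ \ \forall i\in I_m,\ j\in I_p\},$$ $$\mathcal S_a=\{\varsigma\in\mathcal V_a^*:\mathbf f\in \mathrm{Col}(G(\varsigma))\},$$ where $\mathrm{Col}(M)$ is the column space of $M$. The symbol $(G(\varsigma))^{-1}$ denotes the inverse if $G(\varsigma)$ is nonsingular and the (Moore–Penrose) pseudo-inverse if it is singular. Canonical dual function $\Pi^d:\mathcal S_a\to\mathbb R$: $$\Pi^d(\tau,\sigma)=-\tfrac12\mathbf f^t(G(\varsigma))^{-1}\mathbf f-\sum_{i\in I_m}(\tau_i\ln\tau_i-\tau_i)-\sum_{j\in I_p}\tfrac{1}{2b_j}\sigma_j^2-\alpha^t\tau-\theta^t\sigma.$$ Stationary point means point of vanishing gradient, the gradient of $\Pi^d$ being given by $$(\nabla_\tau\Pi^d(\varsigma))_i=\tfrac12\mathbf f^t(G(\varsigma))^{-1}B_i(G(\varsigma))^{-1}\mathbf f-\ln\tau_i-\alpha_i\quad(i\in I_m),$$ $$(\nabla_\sigma\Pi^d(\varsigma))_j=\tfrac12\mathbf f^t(G(\varsigma))^{-1}C_j(G(\varsigma))^{-1}\mathbf f-\tfrac{\sigma_j}{b_j}-\theta_j\quad(j\in I_p).$$ *)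

theory Defs
  imports "HOL-Analysis.Analysis"
begin

definition symmetric_matrix :: "real^'n^'n \<Rightarrow> bool"
  where "symmetric_matrix M \<longleftrightarrow> transpose M = M"

definition pos_semidef :: "real^'n^'n \<Rightarrow> bool"
  where "pos_semidef M \<longleftrightarrow> symmetric_matrix M \<and> (\<forall>x. 0 \<le> x \<bullet> (M *v x))"

definition pos_def :: "real^'n^'n \<Rightarrow> bool"
  where "pos_def M \<longleftrightarrow> symmetric_matrix M \<and> (\<forall>x. x \<noteq> 0 \<longrightarrow> 0 < x \<bullet> (M *v x))"

definition column_space :: "real^'n^'m \<Rightarrow> (real^'m) set"
  where "column_space M = span (columns M)"

definition is_moore_penrose :: "real^'n^'m \<Rightarrow> real^'m^'n \<Rightarrow> bool"
  where "is_moore_penrose M X \<longleftrightarrow>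
    M ** X ** M = M \<and> X ** M ** X = X \<and>
    transpose (M ** X) = M ** X \<and> transpose (X ** M) = X ** M"

definition moore_penrose_inv :: "real^'n^'m \<Rightarrow> real^'m^'n"
  where "moore_penrose_inv M = (THE X. is_moore_penrose M X)"

definition gen_inv :: "real^'n^'n \<Rightarrow> real^'n^'n"
  where "gen_inv M = (if invertible M then matrix_inv M else moore_penrose_inv M)"

definition primal ::
  "real^'n^'n \<Rightarrow> ('m::finite \<Rightarrow> real^'n^'n) \<Rightarrow> ('p::finite \<Rightarrow> real^'n^'n) \<Rightarrow>
   real^'p \<Rightarrow> real^'m \<Rightarrow> real^'p \<Rightarrow> real^'n \<Rightarrow> real^'n \<Rightarrow> real"
  where "primal A B C b \<alpha> \<theta> f x =
    (\<Sum>i\<in>UNIV. exp (1/2 * (x \<bullet> (B i *v x)) - \<alpha> $ i))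
    + (\<Sum>j\<in>UNIV. (b $ j / 2) * (1/2 * (x \<bullet> (C j *v x)) - \<theta> $ j)\<^sup>2)
    + 1/2 * (x \<bullet> (A *v x)) - f \<bullet> x"

definition G ::
  "real^'n^'n \<Rightarrow> ('m::finite \<Rightarrow> real^'n^'n) \<Rightarrow> ('p::finite \<Rightarrow> real^'n^'n) \<Rightarrow>
   (real^'m) \<times> (real^'p) \<Rightarrow> real^'n^'n"
  where "G A B C = (\<lambda>(\<tau>, \<sigma>).
    A + (\<Sum>i\<in>UNIV. \<tau> $ i *\<^sub>R B i) + (\<Sum>j\<in>UNIV. \<sigma> $ j *\<^sub>R C j))"

definition Va :: "real^'p \<Rightarrow> real^'m \<Rightarrow> real^'p \<Rightarrow> ((real^'m) \<times> (real^'p)) set"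
  where "Va b \<alpha> \<theta> =
    {(\<tau>, \<sigma>). (\<forall>i. \<tau> $ i \<in> {exp (- \<alpha> $ i)..}) \<and> (\<forall>j. \<sigma> $ j \<in> {- b $ j * \<theta> $ j..})}"

definition Sa ::
  "real^'n^'n \<Rightarrow> ('m::finite \<Rightarrow> real^'n^'n) \<Rightarrow> ('p::finite \<Rightarrow> real^'n^'n) \<Rightarrow>
   real^'p \<Rightarrow> real^'m \<Rightarrow> real^'p \<Rightarrow> real^'n \<Rightarrow> ((real^'m) \<times> (real^'p)) set"
  where "Sa A B C b \<alpha> \<theta> f = {\<zeta> \<in> Va b \<alpha> \<theta>. f \<in> column_space (G A B C \<zeta>)}"

definition dual ::
  "real^'n^'n \<Rightarrow> ('m::finite \<Rightarrow> real^'n^'n) \<Rightarrow> ('p::finite \<Rightarrow> real^'n^'n) \<Rightarrow>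
   real^'p \<Rightarrow> real^'m \<Rightarrow> real^'p \<Rightarrow> real^'n \<Rightarrow> (real^'m) \<times> (real^'p) \<Rightarrow> real"
  where "dual A B C b \<alpha> \<theta> f = (\<lambda>(\<tau>, \<sigma>).
    - 1/2 * (f \<bullet> (gen_inv (G A B C (\<tau>, \<sigma>)) *v f))
    - (\<Sum>i\<in>UNIV. \<tau> $ i * ln (\<tau> $ i) - \<tau> $ i)
    - (\<Sum>j\<in>UNIV. 1 / (2 * b $ j) * (\<sigma> $ j)\<^sup>2)
    - \<alpha> \<bullet> \<tau> - \<theta> \<bullet> \<sigma>)"

text \<open>The gradient of the dual function is given by its explicit formula: the dual function is
  only considered on \<^const>\<open>Sa\<close>, which need not be open, and the formula is also used where
  \<^const>\<open>G\<close> is singular.\<close>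

definition dual_gradient ::
  "real^'n^'n \<Rightarrow> ('m::finite \<Rightarrow> real^'n^'n) \<Rightarrow> ('p::finite \<Rightarrow> real^'n^'n) \<Rightarrow>
   real^'p \<Rightarrow> real^'m \<Rightarrow> real^'p \<Rightarrow> real^'n \<Rightarrow>
   (real^'m) \<times> (real^'p) \<Rightarrow> (real^'m) \<times> (real^'p)"
  where "dual_gradient A B C b \<alpha> \<theta> f = (\<lambda>(\<tau>, \<sigma>).
    let H = gen_inv (G A B C (\<tau>, \<sigma>)) in
      (\<chi> i. 1/2 * (f \<bullet> ((H ** B i ** H) *v f)) - ln (\<tau> $ i) - \<alpha> $ i,
       \<chi> j. 1/2 * (f \<bullet> ((H ** C j ** H) *v f)) - \<sigma> $ j / b $ j - \<theta> $ j))"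

lemma is_moore_penrose_unique:
  assumes X: "is_moore_penrose M X" and Y: "is_moore_penrose M Y"
  shows "X = Y"
proof -
  have x: "M ** X ** M = M" "X ** M ** X = X" "transpose (M ** X) = M ** X"
      "transpose (X ** M) = X ** M"
    and y: "M ** Y ** M = M" "Y ** M ** Y = Y" "transpose (M ** Y) = M ** Y"
      "transpose (Y ** M) = Y ** M"
    using X Y by (auto simp: is_moore_penrose_def)
  have "M ** X = (M ** Y) ** (M ** X)"
    using y(1) by (metis matrix_mul_assoc)
  also have "\<dots> = transpose ((M ** X) ** (M ** Y))"
    by (simp only: matrix_transpose_mul[of "M ** X" "M ** Y"] x(3) y(3))
  also have "\<dots> = transpose (M ** Y)"
    using x(1) by (metis matrix_mul_assoc)
  finally have MX: "M ** X = M ** Y" using y(3) by simp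
  have "X ** M = (X ** M) ** (Y ** M)"
    using y(1) by (metis matrix_mul_assoc)
  also have "\<dots> = transpose ((Y ** M) ** (X ** M))"
    by (simp only: matrix_transpose_mul[of "Y ** M" "X ** M"] x(4) y(4))
  also have "\<dots> = transpose (Y ** M)"
    using x(1) by (metis matrix_mul_assoc)
  finally have XM: "X ** M = Y ** M" using y(4) by simp
  show ?thesis
    using MX XM x(2) y(2) by (metis matrix_mul_assoc)
qed

lemma orthogonal_projection_matrix:
  fixes S :: "(real^'n) set"
  assumes "subspace S"
  obtains P where "transpose P = P" "\<And>x. P *v x \<in> S" "\<And>x y. y \<in> S \<Longrightarrow> (x - P *v x) \<bullet> y = 0"
proof -
  obtain E where E: "E \<subseteq> S" "pairwise orthogonal E" "\<And>x. x \<in> E \<Longrightarrow> norm x = 1"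
      "independent E" "span E = S"
    using orthonormal_basis_subspace[OF assms] by metis
  have fin: "finite E" using E(4) by (rule independent_imp_finite)
  define p where "p = (\<lambda>x. \<Sum>e\<in>E. (x \<bullet> e) *\<^sub>R e)"
  have lin: "linear p"
    unfolding p_def
    by (intro linearI) (simp_all add: inner_add_left scaleR_left_distrib sum.distrib scaleR_sum_right)
  have pv: "matrix p *v x = p x" for x
    using lin by (simp add: matrix_works)
  have pS: "p x \<in> S" for x
    unfolding p_def using E(1) assms by (auto intro!: subspace_sum subspace_scale)
  have sym: "p x \<bullet> y = x \<bullet> p y" for x y
    unfolding p_def by (simp add: inner_sum_left inner_sum_right inner_commute mult.commute)
  have orth: "(x - p x) \<bullet> e = 0" if e: "e \<in> E" for x e
  proof -
    have "p x \<bullet> e = (\<Sum>d\<in>E. if d = e then x \<bullet> e else 0)"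
      unfolding p_def inner_sum_left
    proof (rule sum.cong)
      fix d assume d: "d \<in> E"
      show "(x \<bullet> d) *\<^sub>R d \<bullet> e = (if d = e then x \<bullet> e else 0)"
      proof (cases "d = e")
        case True
        then show ?thesis using E(3)[OF e] by (simp add: norm_eq_1)
      next
        case False
        then have "d \<bullet> e = 0" using E(2) d e by (auto simp: pairwise_def orthogonal_def)
        then show ?thesis using False by simp
      qed
    qed simp
    also have "\<dots> = x \<bullet> e" using e fin by simp
    finally show ?thesis by (simp add: inner_diff_left)
  qed
  have orthS: "(x - p x) \<bullet> y = 0" if "y \<in> S" for x y
  proof -
    have "y \<in> span E" using that E(5) by simp
    then show ?thesis
      by (induction rule: span_induct_alt) (simp_all add: inner_add_right orth)
  qed
  have "(transpose (matrix p)) *v x = matrix p *v x" for x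
  proof -
    have "(transpose (matrix p) *v x - matrix p *v x) \<bullet> y = 0" for y
      by (simp add: inner_diff_left dot_lmul_matrix pv sym)
    then show ?thesis
      using inner_eq_zero_iff eq_iff_diff_eq_0 by blast
  qed
  then have "transpose (matrix p) = matrix p"
    by (simp add: matrix_eq)
  then show ?thesis
    using that[of "matrix p"] pv pS orthS by simp
qed

lemma is_moore_penrose_exists: "\<exists>X. is_moore_penrose M X"
  for M :: "real^'n^'m"
proof -
  define V where "V = range ((*v) (transpose M))"
  define W where "W = range ((*v) M)"
  have subV: "subspace V" and subW: "subspace W"
    unfolding V_def W_def
    by (rule linear_subspace_image matrix_vector_mul_linear subspace_UNIV)+
  obtain P where P: "transpose P = P" "\<And>x. P *v x \<in> W" "\<And>x y. y \<in> W \<Longrightarrow> (x - P *v x) \<bullet> y = 0"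
    using orthogonal_projection_matrix[OF subW] by metis
  obtain Q where Q: "transpose Q = Q" "\<And>x. Q *v x \<in> V" "\<And>x y. y \<in> V \<Longrightarrow> (x - Q *v x) \<bullet> y = 0"
    using orthogonal_projection_matrix[OF subV] by metis
  have pfix: "R *v y = y" if R: "\<And>x. R *v x \<in> S" "\<And>x y. y \<in> S \<Longrightarrow> (x - R *v x) \<bullet> y = 0"
    and S: "subspace S" "y \<in> S" for R :: "real^'k^'k" and S y
  proof -
    have "y - R *v y \<in> S" using R S by (simp add: subspace_diff)
    then have "(y - R *v y) \<bullet> (y - R *v y) = 0" using R(2) by blast
    then show ?thesis by simp
  qed
  have adj: "(M *v x) \<bullet> z = x \<bullet> (transpose M *v z)" for x z
    by (simp add: dot_lmul_matrix inner_commute[of _ z] inner_commute[of x])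
  have MQ: "M *v (Q *v w) = M *v w" for w
  proof -
    have "(M *v (w - Q *v w)) \<bullet> z = 0" for z
      unfolding adj by (rule Q(3)) (simp add: V_def)
    then have "M *v (w - Q *v w) = 0"
      using inner_eq_zero_iff by blast
    then show ?thesis by (simp add: matrix_vector_mult_diff_distrib)
  qed
  have inj: "inj_on ((*v) M) V"
  proof (rule inj_onI)
    fix x y assume xy: "x \<in> V" "y \<in> V" "M *v x = M *v y"
    then obtain z where z: "x - y = transpose M *v z"
      using subspace_diff[OF subV] by (force simp: V_def)
    have "(x - y) \<bullet> (x - y) = (M *v (x - y)) \<bullet> z"
      unfolding adj z ..
    also have "\<dots> = 0" using xy(3) by (simp add: matrix_vector_mult_diff_distrib)
    finally show "x = y" by simp
  qed
  obtain g where g: "range g \<subseteq> V" "linear g" "\<forall>v\<in>V. g (M *v v) = v"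
    using linear_exists_left_inverse_on[OF matrix_vector_mul_linear subV inj] by metis
  define X where "X = matrix g ** P"
  have X: "X *v y = g (P *v y)" for y
    unfolding X_def using g(2) by (simp add: matrix_vector_mul_assoc[symmetric] matrix_works)
  have gM: "g (M *v w) = Q *v w" for w
    using bspec[OF g(3) Q(2)[of w]] by (simp only: MQ)
  have PM: "P *v (M *v w) = M *v w" for w
    by (rule pfix[OF P(2,3) subW]) (auto simp: W_def)
  have Mg: "M *v g (P *v y) = P *v y" for y
  proof -
    obtain w where "P *v y = M *v w" using P(2)[of y] by (auto simp: W_def)
    then show ?thesis by (simp add: gM MQ)
  qed
  have 1: "M ** X = P"
    by (simp add: matrix_eq matrix_vector_mul_assoc[symmetric] X Mg)
  have 2: "X ** M = Q"
    by (simp add: matrix_eq matrix_vector_mul_assoc[symmetric] X PM gM)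
  have 3: "Q ** X = X"
  proof -
    have "Q *v g y = g y" for y
      by (rule pfix[OF Q(2,3) subV]) (use g(1) in auto)
    then show ?thesis
      by (simp add: matrix_eq matrix_vector_mul_assoc[symmetric] X)
  qed
  have 4: "P ** M = M"
    by (simp add: matrix_eq matrix_vector_mul_assoc[symmetric] PM)
  show ?thesis
    unfolding is_moore_penrose_def
    by (rule exI[of _ X]) (simp add: 1 2 3 4 P(1) Q(1))
qed

lemma is_moore_penrose_inv: "is_moore_penrose M (moore_penrose_inv M)"
  unfolding moore_penrose_inv_def
  by (rule theI') (use is_moore_penrose_exists is_moore_penrose_unique in blast)

end

theory Submission
  imports Defs
begin

text \<open>This is Legendre duality applied to the outer functions of the primal terms. Writing the
  primal function as \<open>\<Sum> \<phi>\<^sub>k (q\<^sub>k x)\<close> plus a quadratic, with \<open>q\<^sub>k\<close> a quadratic form and \<open>\<phi>\<^sub>k\<close> an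
  exponential or a square, one has \<open>\<phi>\<^sub>k (q) = q s - \<phi>\<^sub>k\<^sup>* (s)\<close> as soon as \<open>s = \<phi>\<^sub>k' (q)\<close>; the dual
  function arises by then replacing \<open>x\<^sup>t (G \<zeta>) x / 2 - f\<^sup>t x\<close> by its stationary value.
  Put \<open>\<zeta> = (\<tau>, \<sigma>)\<close>, \<open>H = gen_inv (G \<zeta>)\<close> and \<open>x = H f\<close>.

  Two facts about \<open>H\<close> carry everything. Since \<open>G \<zeta>\<close> is symmetric and the Moore--Penrose inverse
  is unique, \<open>H\<close> is symmetric (\<open>transpose_gen_inv\<close>), so that \<open>f\<^sup>t H B\<^sub>i H f = x\<^sup>t B\<^sub>i x\<close>. And since
  \<open>f\<close> lies in the column space of \<open>G \<zeta>\<close>, on which \<open>G \<zeta> H\<close> acts as the identity, \<open>x\<close> solves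
  \<open>G \<zeta> x = f\<close> even when \<open>G \<zeta>\<close> is singular (\<open>gen_inv_solves\<close>).

  By the first fact the vanishing of the dual gradient says
  \<open>\<tau>\<^sub>i = exp (x\<^sup>t B\<^sub>i x / 2 - \<alpha>\<^sub>i)\<close> and \<open>\<sigma>\<^sub>j = b\<^sub>j (x\<^sup>t C\<^sub>j x / 2 - \<theta>\<^sub>j)\<close> (\<open>dual_stationary_imp\<close>), which
  are the relations \<open>s = \<phi>\<^sub>k' (q\<^sub>k x)\<close>. By the chain rule the primal gradient at \<open>x\<close> is therefore
  \<open>G \<zeta> x - f\<close> (\<open>GDERIV_primal\<close>), which is \<open>0\<close> by the second fact. The values agree
  (\<open>primal_eq_dual\<close>) by the Legendre identities and \<open>f\<^sup>t x = x\<^sup>t (G \<zeta>) x\<close>.\<close>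

text \<open>An ordinary inverse satisfies the Penrose equations, so the singular and the nonsingular
  case need no separate treatment afterwards.\<close>

lemma gen_inv_is_moore_penrose: "is_moore_penrose M (gen_inv M)"
proof (cases "invertible M")
  case True
  then show ?thesis
    unfolding gen_inv_def is_moore_penrose_def invertible_def matrix_inv_def
    by (auto intro: someI2_ex simp: transpose_mat)
next
  case False
  then show ?thesis
    by (simp add: gen_inv_def is_moore_penrose_inv)
qed

text \<open>Transposition exchanges the two symmetry conditions among the Penrose equations and
  preserves the other two, so the claim follows from uniqueness.\<close>

lemma transpose_gen_inv:
  assumes "symmetric_matrix M"
  shows "transpose (gen_inv M) = gen_inv M"
proof (rule is_moore_penrose_unique)
  let ?X = "gen_inv M"
  have M: "transpose M = M"
    using assms by (simp add: symmetric_matrix_def)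
  have X: "M ** ?X ** M = M" "?X ** M ** ?X = ?X"
    "transpose (M ** ?X) = M ** ?X" "transpose (?X ** M) = ?X ** M"
    using gen_inv_is_moore_penrose[of M] by (auto simp: is_moore_penrose_def)
  have MX: "M ** transpose ?X = ?X ** M" and XM: "transpose ?X ** M = M ** ?X"
    using X(3,4) by (simp_all add: matrix_transpose_mul M)
  have "M ** transpose ?X ** M = M"
    using arg_cong[OF X(1), of transpose] by (simp add: matrix_transpose_mul M matrix_mul_assoc)
  moreover have "transpose ?X ** M ** transpose ?X = transpose ?X"
    using arg_cong[OF X(2), of transpose] by (simp add: matrix_transpose_mul M matrix_mul_assoc)
  ultimately show "is_moore_penrose M (transpose ?X)"
    by (simp add: is_moore_penrose_def MX XM X(3,4))
qed (rule gen_inv_is_moore_penrose)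

lemma gen_inv_solves:
  assumes "f \<in> column_space M"
  shows "M *v (gen_inv M *v f) = f"
proof -
  have "f \<in> (*v) M ` span (range (\<lambda>i. axis i 1))"
    using assms unfolding column_space_def columns_image_basis
    by (simp only: linear_span_image[OF matrix_vector_mul_linear])
  then obtain y where f: "f = M *v y"
    by blast
  have "M ** gen_inv M ** M = M"
    using gen_inv_is_moore_penrose[of M] by (simp add: is_moore_penrose_def)
  then show ?thesis
    by (simp add: f matrix_vector_mul_assoc matrix_mul_assoc)
qed

lemma inner_symmetric_matrix:
  assumes "symmetric_matrix M"
  shows "(M *v x) \<bullet> y = x \<bullet> (M *v y)"
proof -
  have "(M *v x) \<bullet> y = (transpose M *v x) \<bullet> y"
    using assms by (simp only: symmetric_matrix_def)
  also have "\<dots> = x \<bullet> (M *v y)"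
    by (simp add: dot_lmul_matrix)
  finally show ?thesis .
qed

lemma sum_scaleR_matrix_vector:
  fixes M :: "'i \<Rightarrow> real^'n^'m"
  shows "(\<Sum>i\<in>I. t i *\<^sub>R M i) *v x = (\<Sum>i\<in>I. t i *\<^sub>R (M i *v x))"
  by (induction I rule: infinite_finite_induct)
    (simp_all add: matrix_vector_mult_add_rdistrib scaleR_matrix_vector_assoc)

lemma G_mult_vector:
  "G A B C (\<tau>, \<sigma>) *v x =
    A *v x + (\<Sum>i\<in>UNIV. \<tau> $ i *\<^sub>R (B i *v x)) + (\<Sum>j\<in>UNIV. \<sigma> $ j *\<^sub>R (C j *v x))"
  by (simp add: G_def matrix_vector_mult_add_rdistrib sum_scaleR_matrix_vector)

lemma symmetric_matrix_G:
  assumes "symmetric_matrix A" "\<And>i. symmetric_matrix (B i)" "\<And>j. symmetric_matrix (C j)"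
  shows "symmetric_matrix (G A B C (\<tau>, \<sigma>))"
  using assms by (simp add: symmetric_matrix_def G_def transpose_def vec_eq_iff)

lemma GDERIV_quadratic_form:
  fixes M :: "real^'n^'n"
  assumes "symmetric_matrix M"
  shows "GDERIV (\<lambda>x. 1/2 * (x \<bullet> (M *v x))) x :> M *v x"
proof -
  have "((*v) M has_derivative (*v) M) (at x)"
    by (rule linear_imp_has_derivative) (rule matrix_vector_mul_linear)
  then have "((\<lambda>x. 1/2 * (x \<bullet> (M *v x))) has_derivative
      (\<lambda>h. 1/2 * (x \<bullet> (M *v h) + h \<bullet> (M *v x)))) (at x)"
    by (intro has_derivative_mult_right has_derivative_inner has_derivative_ident)
  moreover have "x \<bullet> (M *v h) = h \<bullet> (M *v x)" for h
    using inner_symmetric_matrix[OF assms, of x h] by (simp add: inner_commute)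
  ultimately show ?thesis
    by (simp add: gderiv_def)
qed

lemma GDERIV_sum:
  assumes "\<And>i. i \<in> I \<Longrightarrow> GDERIV (g i) x :> D i"
  shows "GDERIV (\<lambda>x. \<Sum>i\<in>I. g i x) x :> (\<Sum>i\<in>I. D i)"
  using assms unfolding gderiv_def by (auto intro!: derivative_eq_intros simp: inner_sum_right)

text \<open>Read with \<open>\<tau>\<^sub>i = exp (x\<^sup>t B\<^sub>i x / 2 - \<alpha>\<^sub>i)\<close> and \<open>\<sigma>\<^sub>j = b\<^sub>j (x\<^sup>t C\<^sub>j x / 2 - \<theta>\<^sub>j)\<close>, the chain rule
  makes the quadratic forms recombine into \<^const>\<open>G\<close>.\<close>

lemma GDERIV_primal:
  fixes A :: "real^'n^'n" and B :: "'m::finite \<Rightarrow> real^'n^'n" and C :: "'p::finite \<Rightarrow> real^'n^'n"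
  assumes sym: "symmetric_matrix A" "\<And>i. symmetric_matrix (B i)" "\<And>j. symmetric_matrix (C j)"
    and \<tau>: "\<And>i. \<tau> $ i = exp (1/2 * (x \<bullet> (B i *v x)) - \<alpha> $ i)"
    and \<sigma>: "\<And>j. \<sigma> $ j = b $ j * (1/2 * (x \<bullet> (C j *v x)) - \<theta> $ j)"
  shows "GDERIV (primal A B C b \<alpha> \<theta> f) x :> G A B C (\<tau>, \<sigma>) *v x - f"
proof -
  have exp_term: "GDERIV (\<lambda>x. exp (1/2 * (x \<bullet> (B i *v x)) - \<alpha> $ i)) x :> \<tau> $ i *\<^sub>R (B i *v x)" for i
  proof (rule GDERIV_DERIV_compose[where g = "\<lambda>t. exp (t - \<alpha> $ i)"])
    show "GDERIV (\<lambda>x. 1/2 * (x \<bullet> (B i *v x))) x :> B i *v x"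
      by (rule GDERIV_quadratic_form[OF sym(2)])
  qed (auto intro!: derivative_eq_intros simp: \<tau>)
  have square_term:
    "GDERIV (\<lambda>x. b $ j / 2 * (1/2 * (x \<bullet> (C j *v x)) - \<theta> $ j)\<^sup>2) x :> \<sigma> $ j *\<^sub>R (C j *v x)" for j
  proof (rule GDERIV_DERIV_compose[where g = "\<lambda>t. b $ j / 2 * (t - \<theta> $ j)\<^sup>2"])
    show "GDERIV (\<lambda>x. 1/2 * (x \<bullet> (C j *v x))) x :> C j *v x"
      by (rule GDERIV_quadratic_form[OF sym(3)])
  qed (auto intro!: derivative_eq_intros simp: \<sigma>)
  have linear_term: "GDERIV (\<lambda>x. f \<bullet> x) x :> f"
    unfolding gderiv_def by (auto intro!: derivative_eq_intros simp: inner_commute)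
  have "GDERIV (primal A B C b \<alpha> \<theta> f) x :>
    (\<Sum>i\<in>UNIV. \<tau> $ i *\<^sub>R (B i *v x)) + (\<Sum>j\<in>UNIV. \<sigma> $ j *\<^sub>R (C j *v x)) + A *v x - f"
    unfolding primal_def
    by (intro GDERIV_diff GDERIV_add GDERIV_sum exp_term square_term linear_term
        GDERIV_quadratic_form[OF sym(1)])
  then show ?thesis
    by (simp add: G_mult_vector add_ac)
qed

text \<open>Stationarity of the dual function pins the dual variables to the derivatives of the outer
  functions of the primal terms. The lower bound on \<open>\<tau>\<close> in \<^const>\<open>Va\<close> makes \<open>\<tau>\<close> positive, which
  is what allows the logarithm to be inverted.\<close>

lemma dual_stationary_imp:
  fixes A :: "real^'n^'n" and B :: "'m::finite \<Rightarrow> real^'n^'n" and C :: "'p::finite \<Rightarrow> real^'n^'n"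
  assumes sym: "symmetric_matrix (G A B C (\<tau>, \<sigma>))"
    and b: "\<And>j. b $ j > 0"
    and Va: "(\<tau>, \<sigma>) \<in> Va b \<alpha> \<theta>"
    and stat: "dual_gradient A B C b \<alpha> \<theta> f (\<tau>, \<sigma>) = 0"
    and x: "x = gen_inv (G A B C (\<tau>, \<sigma>)) *v f"
  shows "\<tau> $ i = exp (1/2 * (x \<bullet> (B i *v x)) - \<alpha> $ i)"
    and "\<sigma> $ j = b $ j * (1/2 * (x \<bullet> (C j *v x)) - \<theta> $ j)"
proof -
  let ?H = "gen_inv (G A B C (\<tau>, \<sigma>))"
  have H: "symmetric_matrix ?H"
    using transpose_gen_inv[OF sym] by (simp add: symmetric_matrix_def)
  have quad: "f \<bullet> ((?H ** M ** ?H) *v f) = x \<bullet> (M *v x)" for M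
    by (simp add: x inner_symmetric_matrix[OF H] matrix_vector_mul_assoc matrix_mul_assoc)
  have "exp (- \<alpha> $ i) \<le> \<tau> $ i"
    using Va by (simp add: Va_def)
  then have pos: "\<tau> $ i > 0"
    using exp_gt_zero less_le_trans by blast
  have "ln (\<tau> $ i) = 1/2 * (x \<bullet> (B i *v x)) - \<alpha> $ i"
    using stat by (simp add: dual_gradient_def Let_def quad zero_prod_def vec_eq_iff algebra_simps)
  then show "\<tau> $ i = exp (1/2 * (x \<bullet> (B i *v x)) - \<alpha> $ i)"
    using pos by (metis exp_ln)
  have "\<sigma> $ j / b $ j = 1/2 * (x \<bullet> (C j *v x)) - \<theta> $ j"
    using stat by (simp add: dual_gradient_def Let_def quad zero_prod_def vec_eq_iff algebra_simps)
  then show "\<sigma> $ j = b $ j * (1/2 * (x \<bullet> (C j *v x)) - \<theta> $ j)"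
    using b[of j] by (simp add: field_simps)
qed

text \<open>The exponential and squared terms satisfy Fenchel's inequality with equality at the
  corresponding dual variables. Besides the conjugates, which the dual function contains as
  well, summation yields \<open>x\<^sup>t (G - A) x / 2\<close>; together with \<open>x\<^sup>t A x / 2 - f\<^sup>t x\<close> this is \<open>- f\<^sup>t x / 2\<close>, because \<open>G x = f\<close>.\<close>

lemma primal_eq_dual:
  fixes A :: "real^'n^'n" and B :: "'m::finite \<Rightarrow> real^'n^'n" and C :: "'p::finite \<Rightarrow> real^'n^'n"
  assumes b: "\<And>j. b $ j > 0"
    and x: "x = gen_inv (G A B C (\<tau>, \<sigma>)) *v f"
    and Gx: "G A B C (\<tau>, \<sigma>) *v x = f"
    and \<tau>: "\<And>i. \<tau> $ i = exp (1/2 * (x \<bullet> (B i *v x)) - \<alpha> $ i)"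
    and \<sigma>: "\<And>j. \<sigma> $ j = b $ j * (1/2 * (x \<bullet> (C j *v x)) - \<theta> $ j)"
  shows "primal A B C b \<alpha> \<theta> f x = dual A B C b \<alpha> \<theta> f (\<tau>, \<sigma>)"
proof -
  have fx: "f \<bullet> x = x \<bullet> (A *v x) + (\<Sum>i\<in>UNIV. \<tau> $ i * (x \<bullet> (B i *v x)))
      + (\<Sum>j\<in>UNIV. \<sigma> $ j * (x \<bullet> (C j *v x)))"
  proof -
    have "f \<bullet> x = x \<bullet> (G A B C (\<tau>, \<sigma>) *v x)"
      by (simp add: Gx inner_commute)
    then show ?thesis
      by (simp add: G_mult_vector inner_add_right inner_sum_right)
  qed
  have exp_term: "exp (1/2 * (x \<bullet> (B i *v x)) - \<alpha> $ i)
      = 1/2 * (\<tau> $ i * (x \<bullet> (B i *v x))) - (\<tau> $ i * ln (\<tau> $ i) - \<tau> $ i) - \<alpha> $ i * \<tau> $ i" for i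
  proof -
    have "ln (\<tau> $ i) = 1/2 * (x \<bullet> (B i *v x)) - \<alpha> $ i"
      by (simp add: \<tau>)
    then have "1/2 * (x \<bullet> (B i *v x)) = ln (\<tau> $ i) + \<alpha> $ i"
      by simp
    then have "1/2 * (\<tau> $ i * (x \<bullet> (B i *v x))) = \<tau> $ i * ln (\<tau> $ i) + \<alpha> $ i * \<tau> $ i"
      by (metis distrib_left mult.commute mult.left_commute)
    then show ?thesis
      unfolding \<tau>[symmetric] by linarith
  qed
  have square_term: "b $ j / 2 * (1/2 * (x \<bullet> (C j *v x)) - \<theta> $ j)\<^sup>2
      = 1/2 * (\<sigma> $ j * (x \<bullet> (C j *v x))) - 1 / (2 * b $ j) * (\<sigma> $ j)\<^sup>2 - \<theta> $ j * \<sigma> $ j" for j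
    using b[of j] by (simp add: \<sigma> power2_eq_square field_simps)
  show ?thesis
    using fx unfolding primal_def dual_def exp_term square_term
    by (simp add: x[symmetric] inner_vec_def[of \<alpha>] inner_vec_def[of \<theta>] sum.distrib sum_subtractf
        sum_divide_distrib[symmetric] add_divide_distrib)
qed

theorem theorem1:
  fixes f :: "real^'n"
    and A :: "real^'n^'n"
    and B :: "'m::finite \<Rightarrow> real^'n^'n"
    and C :: "'p::finite \<Rightarrow> real^'n^'n"
    and b \<theta> :: "real^'p"
    and \<alpha> :: "real^'m"
    and \<zeta> :: "(real^'m) \<times> (real^'p)"
    and x :: "real^'n"
  assumes "symmetric_matrix A"
    and "\<forall>j. b $ j > 0"
    and "\<forall>i. pos_semidef (B i)"
    and "\<forall>j. pos_semidef (C j)"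
    and "\<exists>M \<in> convex_cone hull (range B \<union> range C). pos_def M"
    and "Sa A B C b \<alpha> \<theta> f \<noteq> {}"
    and "\<zeta> \<in> Sa A B C b \<alpha> \<theta> f"
    and "dual_gradient A B C b \<alpha> \<theta> f \<zeta> = 0"
    and "x = gen_inv (G A B C \<zeta>) *v f"
  shows "GDERIV (primal A B C b \<alpha> \<theta> f) x :> 0 \<and>
    primal A B C b \<alpha> \<theta> f x = dual A B C b \<alpha> \<theta> f \<zeta>"
proof -
  obtain \<tau> \<sigma> where \<zeta>: "\<zeta> = (\<tau>, \<sigma>)"
    by (cases \<zeta>)
  have b: "\<And>j. b $ j > 0"
    using assms(2) by simp
  have sym: "symmetric_matrix A" "\<And>i. symmetric_matrix (B i)" "\<And>j. symmetric_matrix (C j)"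
    using assms(1,3,4) by (simp_all add: pos_semidef_def)
  have Va: "(\<tau>, \<sigma>) \<in> Va b \<alpha> \<theta>" and col: "f \<in> column_space (G A B C (\<tau>, \<sigma>))"
    using assms(7) by (simp_all add: Sa_def \<zeta>)
  have x: "x = gen_inv (G A B C (\<tau>, \<sigma>)) *v f"
    using assms(9) by (simp add: \<zeta>)
  have Gx: "G A B C (\<tau>, \<sigma>) *v x = f"
    unfolding x by (rule gen_inv_solves[OF col])
  note dual_vars = dual_stationary_imp[OF symmetric_matrix_G[OF sym] b Va
      assms(8)[unfolded \<zeta>] x]
  have "GDERIV (primal A B C b \<alpha> \<theta> f) x :> 0"
    using GDERIV_primal[OF sym dual_vars, of f] by (simp add: Gx)
  moreover have "primal A B C b \<alpha> \<theta> f x = dual A B C b \<alpha> \<theta> f \<zeta>"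
    unfolding \<zeta> by (rule primal_eq_dual[OF b x Gx dual_vars])
  ultimately show ?thesis ..
qed

end
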